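(* There is an $\varepsilon_0>0$ (depending on the problem data, the method parameters and the linear system solver) such that for every unit roundoff $0<\varepsilon_{mach}\le\varepsilon_0$ the following holds. Let $\tilde z\in\mathcal{N}_h(\hat\tau,\nu_2)$, where $\hat\tau\in[\sigma\tau_E,\tau_A]$, and let $(\tilde r^{(1)},\tilde r^{(2)},\tilde r^{(3)},\tilde r^{(4)}):=F_{\hat\tau}(\tilde z)$. Solve the linear system $$DF(\tilde z)\,\Delta\tilde z=-(\tilde r^{(1)},\tilde r^{(2)},0_n,0_n)$$ on an IEEE machine with unit roundoff $\varepsilon_{mach}$ with a numerically stable algorithm, and compute $\hat{\tilde z}:=\tilde z+\Delta\tilde z$. Then $\hat{\tilde z}\in\mathcal{N}(\hat\tau,\nu_0)$. If there are no rounding errors, then moreover $\hat{\tilde z}\in\mathcal{N}(\hat\tau)$.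
   Context: $n,m\ge1$; $Q\in\mathbb{R}^{n\times n}$ symmetric positive semidefinite, $c\in\mathbb{R}^n$, $A\in\mathbb{R}^{m\times n}$, $b\in\mathbb{R}^m$, $\mathrm{tol}>0$. $\mathbf 1$ is the all-ones vector; products of vectors of equal length are componentwise. $\|\cdot\|_2$ is the Euclidean/spectral norm, $\|\cdot\|_F$ the Frobenius norm. Method parameters: positive reals satisfying (an upper bound with zero denominator is vacuous) $\theta\le0.3$; $\beta\le\theta$; $1-\beta/\sqrt{2n}\le\sigma<1$; $N=3n+m$; $C_q\ge\|Q\|_2n+\|c\|_2\sqrt n$; $\omega\le\min\{\frac{\mathrm{tol}}{2n},\frac{\mathrm{tol}^2}{16(4C_q+n)},1\}$; $C_\lambda\ge(\|A\|_2\sqrt n+\|b\|_2)/\omega$; $C_{\Delta\mu}\ge(\omega+\|Q\|_2)\sqrt n+\|c\|_2+\|A\|_2C_\lambda$; $\tau_A\ge\max\{\frac14\|Q+\omega I+\frac1\omega A^{\mathsf T}A\|_2,4\|c-\frac1\omega A^{\mathsf T}b\|_2\}$; $\tau_E\le\frac{\mathrm{tol}^2\omega}{48n\max\{\|A\|_2,C_q\}}$; $C_\mu\ge\sqrt{2n}(C_{\Delta\mu}+(1+\theta)\tau_A)$; $C_z\ge\sqrt{n+C_\lambda^2+C_\mu^2}+0.1$; $c_{gap}\le\frac{1-\theta}{1+C_z}\cdot\frac{\sigma\tau_E}2$; $C_{DF}\ge\|Q\|_2+2\omega+2\|A\|_F+4+4C_z$; $C_{DFinv}\ge\frac1{c_{gap}}\max\{\frac1\omega,\frac{C_z}{c_{gap}}\}$;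 $\kappa_{DF}\ge C_{DF}C_{DFinv}$; $C_{\delta F}\ge C_{DF}$; $C_{\delta DF}\ge2$; $C_{\delta\Delta z}\ge2\kappa_{DF}$; $C_\nu\ge\max\{2C_{\delta\Delta z}(C_{\delta F}C_{DFinv}+\frac2\omega C_{\delta DF}C_z),1+C_{DFinv}C_{\delta F}\}$; $\nu_2\le\min\{0.1,\frac{c_{gap}}{C_\nu},\frac\omega{2C_{\delta DF}\kappa_{DF}},\frac{\theta\sigma\tau_E}{2C_\nu C_{\delta F}}\}$; $\nu_1\le\nu_2/C_\nu$; $\nu_0\le\min\{\nu_1/C_\nu,\frac{\mathrm{tol}}{2\max\{\|A\|_2,C_q\}}\}$. For $z=(x,\lambda,\mu_L,\mu_R)\in\mathbb{R}^n\times\mathbb{R}^m\times\mathbb{R}^n\times\mathbb{R}^n=\mathbb{R}^N$ and $\tau>0$: $$F_\tau(z)=\begin{pmatrix}Qx+\omega x+c-A^{\mathsf T}\lambda-\mu_L+\mu_R\\ Ax-b+\omega\lambda\\ \mu_L\cdot(\mathbf 1+x)-\tau\mathbf 1\\ \mu_R\cdot(\mathbf 1-x)-\tau\mathbf 1\end{pmatrix},$$ $$DF(z)=\begin{bmatrix}Q+\omega I&-A^{\mathsf T}&-I&I\\ A&\omega I&0&0\\ \mathrm{diag}(\mu_L)&0&\mathrm{diag}(\mathbf 1+x)&0\\ -\mathrm{diag}(\mu_R)&0&0&\mathrm{diag}(\mathbf 1-x)\end{bmatrix}.$$ $\mathcal{N}(\tau)$ is the set of $z\in\mathbb{R}^N$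 with $F_\tau(z)=(0_n,0_m,r^{(3)},r^{(4)})$, $\|(r^{(3)},r^{(4)})\|_2\le\theta\tau$, $\|x\|_\infty<1$, $\mu_L>0$, $\mu_R>0$; $\mathcal{N}_h(\tau)$ is defined in the same way with $\|(r^{(3)},r^{(4)})\|_2\le0.5\,\theta\tau$. Further $\mathcal{N}(\tau,\nu)=\{\tilde z:\exists z\in\mathcal{N}(\tau),\|\tilde z-z\|_2\le\nu\}$ and $\mathcal{N}_h(\tau,\nu)=\{\tilde z:\exists z\in\mathcal{N}_h(\tau),\|\tilde z-z\|_2\le\nu\}$. Rounding model: computing a step $\tilde z+\Delta\tilde z$ with $DF(\tilde z)\Delta\tilde z=-r$ on an IEEE machine with unit roundoff $\varepsilon_{mach}$ and a numerically stable algorithm means that the computed vector equals $\tilde z-DF(\tilde z)^{-1}r+e$ with a rounding error $e\in\mathbb{R}^N$ obeying $\|e\|_2\le const\cdot C_z\cdot\kappa_{DF}\cdot\varepsilon_{mach}$, where $const$ depends only on the linear system solver. "No rounding errors" means $e=0$. *)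

theory Defs
  imports "HOL-Analysis.Analysis"
begin

text \<open>
  Vectors in $R^n$ have type \<open>real^'n\<close>; on this type \<open>*\<close> is the componentwise product, \<open>1\<close> is the
  all-ones vector and \<open>norm\<close> is the Euclidean norm. On matrices \<open>norm\<close> is the Frobenius norm.
  \<open>mat k\<close> is k times the identity matrix.
\<close>

abbreviation spec_norm :: "real^'a^'b \<Rightarrow> real" where
  "spec_norm M \<equiv> onorm ((*v) M)"

definition diag :: "real^'a \<Rightarrow> real^'a^'a" where
  "diag v = (\<chi> i j. if i = j then v $ i else 0)"

definition sym_psd :: "real^'a^'a \<Rightarrow> bool" where
  "sym_psd M \<longleftrightarrow> transpose M = M \<and> (\<forall>v. 0 \<le> v \<bullet> (M *v v))"

text \<open>
  The space $R^N$ with N = 3n + m is indexed by \<open>'n + 'm + 'n + 'n\<close>, one summand for each of the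
  blocks \<open>(x, lam, muL, muR)\<close>.
\<close>

type_synonym ('n, 'm) ix = "'n + 'm + 'n + 'n"

definition blocks :: "'a^'n \<Rightarrow> 'a^'m \<Rightarrow> 'a^'n \<Rightarrow> 'a^'n \<Rightarrow> 'a^('n::finite, 'm::finite) ix" where
  "blocks x l u v = (\<chi> k. case k of
      Inl i \<Rightarrow> x $ i
    | Inr (Inl j) \<Rightarrow> l $ j
    | Inr (Inr (Inl i)) \<Rightarrow> u $ i
    | Inr (Inr (Inr i)) \<Rightarrow> v $ i)"

text \<open>A row of four matrix blocks, placed side by side. A matrix is the vector of its rows, so
  \<open>blocks\<close> applied to four such rows stacks them.\<close>

definition block_row ::
  "'a^'n^'r \<Rightarrow> 'a^'m^'r \<Rightarrow> 'a^'n^'r \<Rightarrow> 'a^'n^'r \<Rightarrow> 'a^('n::finite, 'm::finite) ix^'r" where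
  "block_row B1 B2 B3 B4 = (\<chi> i. blocks (B1 $ i) (B2 $ i) (B3 $ i) (B4 $ i))"

definition blk1 :: "'a^('n::finite, 'm::finite) ix \<Rightarrow> 'a^'n" where
  "blk1 z = (\<chi> i. z $ Inl i)"

definition blk2 :: "'a^('n::finite, 'm::finite) ix \<Rightarrow> 'a^'m" where
  "blk2 z = (\<chi> j. z $ Inr (Inl j))"

definition blk3 :: "'a^('n::finite, 'm::finite) ix \<Rightarrow> 'a^'n" where
  "blk3 z = (\<chi> i. z $ Inr (Inr (Inl i)))"

definition blk4 :: "'a^('n::finite, 'm::finite) ix \<Rightarrow> 'a^'n" where
  "blk4 z = (\<chi> i. z $ Inr (Inr (Inr i)))"

definition F :: "real^'n^'n \<Rightarrow> real^'n \<Rightarrow> real^'n^'m \<Rightarrow> real^'m \<Rightarrow> real \<Rightarrow> real \<Rightarrow>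
    real^('n::finite, 'm::finite) ix \<Rightarrow> real^('n::finite, 'm::finite) ix" where
  "F Q c A b \<omega> \<tau> z =
    (let x = blk1 z; lam = blk2 z; muL = blk3 z; muR = blk4 z in
      blocks
        (Q *v x + \<omega> *\<^sub>R x + c - transpose A *v lam - muL + muR)
        (A *v x - b + \<omega> *\<^sub>R lam)
        (muL * (1 + x) - \<tau> *\<^sub>R 1)
        (muR * (1 - x) - \<tau> *\<^sub>R 1))"

definition DF :: "real^'n^'n \<Rightarrow> real^'n^'m \<Rightarrow> real \<Rightarrow>
    real^('n::finite, 'm::finite) ix \<Rightarrow>
    real^('n::finite, 'm::finite) ix^('n::finite, 'm::finite) ix" where
  "DF Q A \<omega> z =
    (let x = blk1 z; muL = blk3 z; muR = blk4 z in
      blocks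
        (block_row (Q + mat \<omega>)   (- transpose A) (- mat 1)      (mat 1))
        (block_row A             (mat \<omega>)         0              0)
        (block_row (diag muL)    0               (diag (1 + x)) 0)
        (block_row (- diag muR)  0               0              (diag (1 - x))))"

text \<open>With \<open>rho = \<theta>\<close> this is the neighbourhood $N(tau)$, with \<open>rho = 0.5 * \<theta>\<close> it is $N_h(tau)$.
  The norm of the pair \<open>(r3, r4)\<close> is the Euclidean norm on the product space.\<close>

definition nbhd :: "real^'n^'n \<Rightarrow> real^'n \<Rightarrow> real^'n^'m \<Rightarrow> real^'m \<Rightarrow> real \<Rightarrow> real \<Rightarrow> real \<Rightarrow>
    (real^('n::finite, 'm::finite) ix) set" where
  "nbhd Q c A b \<omega> rho \<tau> =
    {z. (\<exists>r3 r4. F Q c A b \<omega> \<tau> z = blocks 0 0 r3 r4 \<and> norm (r3, r4) \<le> rho * \<tau>) \<and>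
        infnorm (blk1 z) < 1 \<and> (\<forall>i. 0 < blk3 z $ i) \<and> (\<forall>i. 0 < blk4 z $ i)}"

definition tube :: "'a::real_normed_vector set \<Rightarrow> real \<Rightarrow> 'a set" where
  "tube S \<nu> = {z'. \<exists>z\<in>S. norm (z' - z) \<le> \<nu>}"

end

theory Submission
  imports Defs
begin

text \<open>
  The step is a Newton step towards \<open>F1 = 0\<close>, \<open>F2 = 0\<close> that leaves the linearised complementarity
  products \<open>F3\<close>, \<open>F4\<close> unchanged. Since \<open>F\<close> is quadratic, with quadratic part confined to its last
  two blocks, the exact step \<open>d\<close> makes \<open>F1\<close> and \<open>F2\<close> vanish, and it adds exactly
  \<open>(dL * dx, - dR * dx)\<close> to \<open>(F3, F4)\<close> (\<open>F_expansion\<close>). So three things have to be controlled.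

  \<^item> The distance to the boundary. Points \<open>z0\<close> of the neighbourhood have norm at most \<open>C_z - 0.1\<close>
    (\<open>nbhd_norm_le\<close>): \<open>lam\<close> and \<open>muL - muR\<close> are determined by \<open>x\<close>, which has
    entries in \<open>(-1, 1)\<close>, and at each index one of the slacks \<open>1 + x\<close>, \<open>1 - x\<close> is at least 1, which
    bounds the multiplier that belongs to it by
    \<open>(1 + \<theta>) * \<tau>\<close>. As each product of a multiplier and its slack is about \<open>\<tau>\<close>, all slacks and
    multipliers at \<open>z0\<close> are then at least \<open>2 * c_gap\<close> (\<open>nbhd_gap\<close>).

  \<^item> The length of \<open>d\<close>. Testing the first two block rows of \<open>DF z d = s\<close> with \<open>(dx, dlam)\<close> cancels
    the \<open>A\<close> terms, and the last two rows turn the coupling terms into positive quadratic forms in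
    \<open>dL\<close> and \<open>dR\<close>; this gives \<open>norm d \<le> max (1 / \<omega>) (C_z / c_gap) * norm s\<close> when \<open>s\<close> vanishes in
    its last two blocks (\<open>DF_energy_estimate\<close>). In particular \<open>DF z\<close> is injective, hence invertible.

  \<^item> The residual. \<open>F\<close> has Lipschitz constant \<open>C_DF\<close> on the ball of radius \<open>C_z\<close>, because
    \<open>F y - F z\<close> is \<open>DF\<close> at the midpoint applied to \<open>y - z\<close>. So all blocks of \<open>F z\<close> differ by at most
    \<open>C_DF * \<nu>2\<close> from those of \<open>F z0\<close>, whose first two vanish.

  With \<open>K = C_DFinv * C_\<delta>F\<close> one gets \<open>norm d \<le> K * \<nu>2\<close>; the new point stays within
  \<open>(1 + K) * \<nu>2 \<le> c_gap\<close> of \<open>z0\<close>, hence in the interior, and the residual grows by at most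
  \<open>C_\<delta>F * \<nu>2 + (K * \<nu>2)\<^sup>2 \<le> \<theta> * \<tau> / 2\<close> (\<open>newton_step_in_nbhd\<close>). A rounding error of norm at most \<open>\<nu>0\<close>
  then stays in the tube, and \<open>\<epsilon>0\<close> is chosen to force this.
\<close>

section \<open>Block vectors and block matrices\<close>

lemma blk_blocks [simp]:
  "blk1 (blocks x l u v) = x" "blk2 (blocks x l u v) = l"
  "blk3 (blocks x l u v) = u" "blk4 (blocks x l u v) = v"
  by (simp_all add: blk1_def blk2_def blk3_def blk4_def blocks_def)

lemma all_ix: "(\<forall>k :: ('n, 'm) ix. P k) \<longleftrightarrow>
    (\<forall>i. P (Inl i)) \<and> (\<forall>j. P (Inr (Inl j))) \<and>
    (\<forall>i. P (Inr (Inr (Inl i)))) \<and> (\<forall>i. P (Inr (Inr (Inr i))))"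
  by (simp add: split_sum_all)

lemma eq_blocks_iff:
  "z = blocks x l u v \<longleftrightarrow> blk1 z = x \<and> blk2 z = l \<and> blk3 z = u \<and> blk4 z = v"
  by (simp add: vec_eq_iff all_ix blocks_def blk1_def blk2_def blk3_def blk4_def)

lemma vec_eq_blk_iff:
  "z = z' \<longleftrightarrow> blk1 z = blk1 z' \<and> blk2 z = blk2 z' \<and> blk3 z = blk3 z' \<and> blk4 z = blk4 z'"
  by (simp add: vec_eq_iff all_ix blk1_def blk2_def blk3_def blk4_def)

lemma blk_add [simp]:
  "blk1 (z + w) = blk1 z + blk1 w" "blk2 (z + w) = blk2 z + blk2 w"
  "blk3 (z + w) = blk3 z + blk3 w" "blk4 (z + w) = blk4 z + blk4 w"
  by (simp_all add: blk1_def blk2_def blk3_def blk4_def vec_eq_iff)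

lemma blk_diff [simp]:
  "blk1 (z - w) = blk1 z - blk1 w" "blk2 (z - w) = blk2 z - blk2 w"
  "blk3 (z - w) = blk3 z - blk3 w" "blk4 (z - w) = blk4 z - blk4 w"
  for z w :: "'a::ab_group_add^('n::finite, 'm::finite) ix"
  by (simp_all add: blk1_def blk2_def blk3_def blk4_def vec_eq_iff)

lemma blk_zero [simp]: "blk1 0 = 0" "blk2 0 = 0" "blk3 0 = 0" "blk4 0 = 0"
  by (simp_all add: blk1_def blk2_def blk3_def blk4_def vec_eq_iff)

lemma sum_ix: "(\<Sum>k\<in>UNIV. f k) = (\<Sum>i\<in>UNIV. f (Inl i)) + (\<Sum>j\<in>UNIV. f (Inr (Inl j)))
    + (\<Sum>i\<in>UNIV. f (Inr (Inr (Inl i)))) + (\<Sum>i\<in>UNIV. f (Inr (Inr (Inr i))))"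
  for f :: "('n::finite, 'm::finite) ix \<Rightarrow> 'a::comm_monoid_add"
  by (simp add: UNIV_Plus_UNIV[symmetric] sum.Plus add.assoc del: UNIV_Plus_UNIV)

lemma inner_blocks:
  "z \<bullet> w = blk1 z \<bullet> blk1 w + blk2 z \<bullet> blk2 w + blk3 z \<bullet> blk3 w + blk4 z \<bullet> blk4 w"
  for z w :: "real^('n::finite, 'm::finite) ix"
  by (simp add: inner_vec_def sum_ix blk1_def blk2_def blk3_def blk4_def)

lemma norm_blocks:
  "(norm z)\<^sup>2 = (norm (blk1 z))\<^sup>2 + (norm (blk2 z))\<^sup>2 + (norm (blk3 z))\<^sup>2 + (norm (blk4 z))\<^sup>2"
  for z :: "real^('n::finite, 'm::finite) ix"
  by (simp add: power2_norm_eq_inner inner_blocks)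

lemma norm_blk_le:
  fixes z :: "real^('n::finite, 'm::finite) ix"
  shows "norm (blk1 z) \<le> norm z" "norm (blk2 z) \<le> norm z"
    "norm (blk3 z) \<le> norm z" "norm (blk4 z) \<le> norm z"
    "norm (blk3 z, blk4 z) \<le> norm z"
  unfolding norm_Pair
  by (rule power2_le_imp_le; simp add: norm_blocks real_sqrt_le_iff)+

lemma norm_le_sum_blk:
  "norm z \<le> norm (blk1 z) + norm (blk2 z) + norm (blk3 z) + norm (blk4 z)"
  for z :: "real^('n::finite, 'm::finite) ix"
  by (rule power2_le_imp_le) (simp_all add: norm_blocks power2_sum algebra_simps)

lemma blocks_mult_vec:
  "blocks R1 R2 R3 R4 *v d = blocks (R1 *v d) (R2 *v d) (R3 *v d) (R4 *v d)"
  for d :: "'a::semiring_1^'k"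
  by (simp add: eq_blocks_iff, simp add: vec_eq_iff matrix_vector_mult_def blocks_def
    blk1_def blk2_def blk3_def blk4_def)

lemma block_row_mult_vec:
  "block_row B1 B2 B3 B4 *v d = B1 *v blk1 d + B2 *v blk2 d + B3 *v blk3 d + B4 *v blk4 d"
  for d :: "'a::semiring_1^('n::finite, 'm::finite) ix"
  by (simp add: vec_eq_iff matrix_vector_mult_def block_row_def sum_ix blocks_def
    blk1_def blk2_def blk3_def blk4_def)

lemma diag_mult_vec: "diag v *v x = v * x"
  by (simp add: vec_eq_iff matrix_vector_mult_def diag_def if_distrib[of "\<lambda>t. t * _"] cong: if_cong)

lemma mat_mult_vec: "mat k *v x = k *\<^sub>R x" for x :: "real^'n"
  by (simp add: vec_eq_iff matrix_vector_mult_def mat_def if_distrib[of "\<lambda>t. t * _"] cong: if_cong)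

lemma uminus_mult_vec: "(- M) *v x = - (M *v x)" for x :: "'a::ring_1^'n"
  by (simp add: vec_eq_iff matrix_vector_mult_def sum_negf)

section \<open>F is quadratic with derivative DF\<close>

lemma DF_mult_vec:
  "DF Q A \<omega> z *v d = blocks
     (Q *v blk1 d + \<omega> *\<^sub>R blk1 d - transpose A *v blk2 d - blk3 d + blk4 d)
     (A *v blk1 d + \<omega> *\<^sub>R blk2 d)
     (blk3 z * blk1 d + (1 + blk1 z) * blk3 d)
     ((1 - blk1 z) * blk4 d - blk4 z * blk1 d)"
  by (simp add: DF_def Let_def blocks_mult_vec block_row_mult_vec diag_mult_vec mat_mult_vec
      uminus_mult_vec matrix_vector_mult_add_rdistrib)

lemma blk_F [simp]:
  "blk1 (F Q c A b \<omega> \<tau> z) =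
     Q *v blk1 z + \<omega> *\<^sub>R blk1 z + c - transpose A *v blk2 z - blk3 z + blk4 z"
  "blk2 (F Q c A b \<omega> \<tau> z) = A *v blk1 z - b + \<omega> *\<^sub>R blk2 z"
  "blk3 (F Q c A b \<omega> \<tau> z) = blk3 z * (1 + blk1 z) - \<tau> *\<^sub>R 1"
  "blk4 (F Q c A b \<omega> \<tau> z) = blk4 z * (1 - blk1 z) - \<tau> *\<^sub>R 1"
  by (simp_all add: F_def Let_def)

lemma F_expansion:
  "F Q c A b \<omega> \<tau> (z + d) = F Q c A b \<omega> \<tau> z + DF Q A \<omega> z *v d
     + blocks 0 0 (blk3 d * blk1 d) (- (blk4 d * blk1 d))"
  unfolding F_def Let_def DF_mult_vec vec_eq_blk_iff blk_add blk_blocks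
    matrix_vector_right_distrib
  by (intro conjI) (simp_all add: scaleR_right_distrib distrib_left distrib_right left_diff_distrib
      right_diff_distrib mult.commute)

text \<open>A quadratic map has exact central differences: both sides of the midpoint contribute the same
  second-order term.\<close>

lemma F_diff_midpoint:
  "F Q c A b \<omega> \<tau> y - F Q c A b \<omega> \<tau> z = DF Q A \<omega> (midpoint y z) *v (y - z)"
proof -
  let ?w = "midpoint y z" and ?d = "(1/2) *\<^sub>R (y - z)"
  have y: "y = ?w + ?d" and z: "z = ?w + (- ?d)"
    by (simp_all add: midpoint_def algebra_simps flip: scaleR_add_left)
  have q: "blocks 0 0 (blk3 (-?d) * blk1 (-?d)) (- (blk4 (-?d) * blk1 (-?d)))
      = blocks 0 0 (blk3 ?d * blk1 ?d) (- (blk4 ?d * blk1 ?d))"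
    by (simp add: eq_blocks_iff, simp add: vec_eq_iff blk1_def blk3_def blk4_def)
  have "F Q c A b \<omega> \<tau> y - F Q c A b \<omega> \<tau> z = DF Q A \<omega> ?w *v ?d - DF Q A \<omega> ?w *v (- ?d)"
    by (subst (1) y, subst (3) z, unfold F_expansion q) simp
  also have "\<dots> = DF Q A \<omega> ?w *v (?d - (- ?d))"
    by (simp only: matrix_vector_mult_diff_distrib)
  also have "?d - (- ?d) = y - z"
    by (simp flip: scaleR_add_left)
  finally show ?thesis .
qed

section \<open>Norm bounds for matrices and componentwise products\<close>

lemma norm_matrix_mult_le_onorm: "norm (M *v x) \<le> spec_norm M * norm x" for M :: "real^'n^'m"
  by (rule onorm) (rule matrix_vector_mul_bounded_linear)

lemma norm_matrix_mult_le_frobenius: "norm (M *v x) \<le> norm M * norm x" for M :: "real^'n^'m"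
proof -
  have "norm (M *v x) = L2_set (\<lambda>i. norm ((M *v x) $ i)) UNIV"
    by (rule norm_vec_def)
  also have "\<dots> \<le> L2_set (\<lambda>i. norm (M $ i) * norm x) UNIV"
    by (rule L2_set_mono)
      (simp_all add: matrix_vector_mul_component Cauchy_Schwarz_ineq2)
  also have "\<dots> = norm M * norm x"
    by (simp add: L2_set_left_distrib norm_vec_def[of M])
  finally show ?thesis .
qed

lemma inner_transpose_mult: "x \<bullet> (transpose M *v y) = (M *v x) \<bullet> y" for M :: "real^'n^'m"
  by (metis dot_lmul_matrix inner_commute transpose_matrix_vector)

lemma norm_transpose_mult_le:
  fixes M :: "real^'n^'m"
  assumes "\<And>x. norm (M *v x) \<le> k * norm x"
  shows "norm (transpose M *v y) \<le> k * norm y"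
proof (cases "transpose M *v y = 0")
  case True
  have "0 \<le> k * norm (axis undefined 1 :: real^'n)"
    using norm_ge_zero assms by (rule order_trans)
  then have "0 \<le> k" by simp
  then show ?thesis using True by simp
next
  case False
  let ?t = "transpose M *v y"
  have "norm ?t * norm ?t = y \<bullet> (M *v ?t)"
    using inner_transpose_mult[of ?t M y]
    by (simp add: inner_commute flip: power2_eq_square power2_norm_eq_inner)
  also have "\<dots> \<le> norm y * (k * norm ?t)"
    using norm_cauchy_schwarz mult_left_mono[OF assms norm_ge_zero] by (rule order_trans)
  finally show ?thesis using False by (simp add: mult.commute)
qed

lemma norm_mult_le_component:
  fixes u x :: "real^'n"
  assumes "\<And>i. \<bar>u $ i\<bar> \<le> k"
  shows "norm (u * x) \<le> k * norm x"
proof -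
  have k: "0 \<le> k" using assms[of undefined] by linarith
  have "norm (u * x) \<le> norm (k *\<^sub>R x)"
    by (rule norm_le_componentwise_cart) (use assms k in \<open>simp add: abs_mult mult_right_mono\<close>)
  then show ?thesis using k by simp
qed

lemma norm_mult_le: "norm (u * x) \<le> norm u * norm x" for u x :: "real^'n"
  by (rule norm_mult_le_component) (rule component_le_norm_cart)


section \<open>Bounds on the neighbourhoods\<close>

lemma infnorm_less_iff: "infnorm x < r \<longleftrightarrow> (\<forall>i. \<bar>x $ i\<bar> < r)" for x :: "real^'n"
  by (auto simp: infnorm_Max Basis_vec_def inner_axis)

lemma nbhd_iff:
  "z \<in> nbhd Q c A b \<omega> \<rho> \<tau> \<longleftrightarrow>
     blk1 (F Q c A b \<omega> \<tau> z) = 0 \<and> blk2 (F Q c A b \<omega> \<tau> z) = 0 \<and>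
     norm (blk3 (F Q c A b \<omega> \<tau> z), blk4 (F Q c A b \<omega> \<tau> z)) \<le> \<rho> * \<tau> \<and>
     (\<forall>i. \<bar>blk1 z $ i\<bar> < 1) \<and> (\<forall>i. 0 < blk3 z $ i) \<and> (\<forall>i. 0 < blk4 z $ i)"
  unfolding nbhd_def mem_Collect_eq eq_blocks_iff infnorm_less_iff by blast

lemma nbhd_complementarity:
  assumes "z \<in> nbhd Q c A b \<omega> \<rho> \<tau>"
  shows "\<bar>blk3 z $ i * (1 + blk1 z $ i) - \<tau>\<bar> \<le> \<rho> * \<tau>"
    and "\<bar>blk4 z $ i * (1 - blk1 z $ i) - \<tau>\<bar> \<le> \<rho> * \<tau>"
proof -
  let ?r3 = "blk3 (F Q c A b \<omega> \<tau> z)" and ?r4 = "blk4 (F Q c A b \<omega> \<tau> z)"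
  have le: "norm (?r3, ?r4) \<le> \<rho> * \<tau>" using assms by (simp only: nbhd_iff)
  have "\<bar>?r3 $ i\<bar> \<le> norm (?r3, ?r4)" "\<bar>?r4 $ i\<bar> \<le> norm (?r3, ?r4)"
    using component_le_norm_cart[of ?r3 i] component_le_norm_cart[of ?r4 i]
      norm_fst_le[of ?r3 ?r4] norm_snd_le[of ?r4 ?r3] by linarith+
  then show "\<bar>blk3 z $ i * (1 + blk1 z $ i) - \<tau>\<bar> \<le> \<rho> * \<tau>"
    and "\<bar>blk4 z $ i * (1 - blk1 z $ i) - \<tau>\<bar> \<le> \<rho> * \<tau>"
    using le by simp_all
qed

lemma norm_le_sqrt_card:
  fixes x :: "real^'n"
  assumes "\<And>i. \<bar>x $ i\<bar> \<le> k"
  shows "norm x \<le> sqrt CARD('n) * k"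
proof -
  have "0 \<le> k" using assms[of undefined] by linarith
  have "norm x \<le> norm (k *\<^sub>R 1 :: real^'n)"
    using assms \<open>0 \<le> k\<close> by (intro norm_le_componentwise_cart) simp
  moreover have "norm (1 :: real^'n) = sqrt CARD('n)"
    by (simp add: norm_vec_def L2_set_def)
  ultimately show ?thesis using \<open>0 \<le> k\<close> by (simp add: mult.commute)
qed

text \<open>The neighbourhoods are bounded uniformly in \<open>\<rho> \<le> \<theta>\<close> and \<open>\<tau> \<le> \<tau>A\<close>; the bound combines those on the blocks
  \<open>x\<close>, \<open>lam\<close> and \<open>(muL, muR)\<close>.\<close>

lemma nbhd_norm_le:
  fixes Q :: "real^'n^'n" and A :: "real^'n^'m" and C_lam C_\<mu> :: real
  assumes z: "z \<in> nbhd Q c A b \<omega> \<rho> \<tau>"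
    and par: "0 \<le> \<rho>" "\<rho> \<le> \<theta>" "0 \<le> \<tau>" "\<tau> \<le> \<tau>A" "0 < \<omega>"
    and C_lam: "(spec_norm A * sqrt CARD('n) + norm b) / \<omega> \<le> C_lam"
    and C_\<Delta>\<mu>: "(\<omega> + spec_norm Q) * sqrt CARD('n) + norm c + spec_norm A * C_lam \<le> C_\<Delta>\<mu>"
    and C_\<mu>: "sqrt (2 * CARD('n)) * (C_\<Delta>\<mu> + (1 + \<theta>) * \<tau>A) \<le> C_\<mu>"
  shows "norm z \<le> sqrt (CARD('n) + C_lam\<^sup>2 + C_\<mu>\<^sup>2)"
proof -
  define x l u v where "x = blk1 z" and "l = blk2 z" and "u = blk3 z" and "v = blk4 z"
  note defs = x_def l_def u_def v_def
  have F1: "Q *v x + \<omega> *\<^sub>R x + c - transpose A *v l - u + v = 0"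
    and F2: "A *v x - b + \<omega> *\<^sub>R l = 0"
    and x1: "\<bar>x $ i\<bar> < 1" and u0: "0 < u $ i" and v0: "0 < v $ i" for i
    using z by (simp_all add: nbhd_iff defs)
  have nx: "norm x \<le> sqrt CARD('n)"
    using norm_le_sqrt_card[of x 1] x1 by (simp add: less_imp_le)
  have nAx: "norm (A *v x) \<le> spec_norm A * sqrt CARD('n)"
    using norm_matrix_mult_le_onorm[of A x] mult_left_mono[OF nx, of "spec_norm A"]
      onorm_pos_le[OF matrix_vector_mul_bounded_linear, of A] by linarith
  have nQx: "norm (Q *v x) \<le> spec_norm Q * sqrt CARD('n)"
    using norm_matrix_mult_le_onorm[of Q x] mult_left_mono[OF nx, of "spec_norm Q"]
      onorm_pos_le[OF matrix_vector_mul_bounded_linear, of Q] by linarith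
  have nl: "norm l \<le> C_lam"
  proof -
    have "\<omega> * norm l = norm (b - A *v x)"
    proof -
      have "b - A *v x = \<omega> *\<^sub>R l" using F2 by (simp add: algebra_simps)
      then show ?thesis using par by simp
    qed
    also have "\<dots> \<le> norm b + spec_norm A * sqrt CARD('n)"
      using norm_triangle_ineq4[of b "A *v x"] nAx by linarith
    also have "\<dots> \<le> \<omega> * C_lam"
      using C_lam par by (simp add: field_simps)
    finally show ?thesis using par by simp
  qed
  have nuv: "norm (u - v) \<le> C_\<Delta>\<mu>"
  proof -
    have "u - v = Q *v x + \<omega> *\<^sub>R x + c - transpose A *v l"
      using F1 by (simp add: algebra_simps)
    then have "norm (u - v) \<le> norm (Q *v x) + norm (\<omega> *\<^sub>R x) + norm c + norm (transpose A *v l)"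
      using norm_triangle_ineq4[of "Q *v x + \<omega> *\<^sub>R x + c" "transpose A *v l"]
        norm_triangle_ineq[of "Q *v x + \<omega> *\<^sub>R x" c]
        norm_triangle_ineq[of "Q *v x" "\<omega> *\<^sub>R x"] by simp
    moreover have "norm (\<omega> *\<^sub>R x) \<le> \<omega> * sqrt CARD('n)"
      using nx par by simp
    moreover have "norm (transpose A *v l) \<le> spec_norm A * norm l"
      by (rule norm_transpose_mult_le) (rule norm_matrix_mult_le_onorm)
    moreover have "spec_norm A * norm l \<le> spec_norm A * C_lam"
      using nl by (intro mult_left_mono onorm_pos_le matrix_vector_mul_bounded_linear)
    ultimately show ?thesis using nQx C_\<Delta>\<mu> by (simp add: algebra_simps)
  qed
  define K where "K = C_\<Delta>\<mu> + (1 + \<theta>) * \<tau>A"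
  have comp: "\<bar>u $ i\<bar> \<le> K \<and> \<bar>v $ i\<bar> \<le> K" for i
  proof -
    have "\<rho> * \<tau> \<le> \<theta> * \<tau>A" using par by (intro mult_mono) auto
    then have up: "u $ i * (1 + x $ i) \<le> (1 + \<theta>) * \<tau>A" "v $ i * (1 - x $ i) \<le> (1 + \<theta>) * \<tau>A"
      using nbhd_complementarity[OF z, of i] par by (simp_all add: defs algebra_simps)
    have d: "\<bar>u $ i - v $ i\<bar> \<le> C_\<Delta>\<mu>"
      using component_le_norm_cart[of "u - v" i] nuv by simp
    \<comment> \<open>the multiplier whose slack is at least 1 is small, and the other one is close to it\<close>
    have "u $ i \<le> (1 + \<theta>) * \<tau>A \<or> v $ i \<le> (1 + \<theta>) * \<tau>A"
    proof (cases "0 \<le> x $ i")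
      case True
      then have "u $ i * 1 \<le> u $ i * (1 + x $ i)" using u0[of i] by (intro mult_left_mono) auto
      then show ?thesis using up by simp
    next
      case False
      then have "v $ i * 1 \<le> v $ i * (1 - x $ i)" using v0[of i] by (intro mult_left_mono) auto
      then show ?thesis using up by simp
    qed
    then show ?thesis using d u0[of i] v0[of i] by (auto simp: K_def abs_le_iff)
  qed
  have K0: "0 \<le> K" using comp[of undefined] by linarith
  have "(norm u)\<^sup>2 + (norm v)\<^sup>2 \<le> (sqrt CARD('n) * K)\<^sup>2 + (sqrt CARD('n) * K)\<^sup>2"
    using comp by (intro add_mono power_mono norm_le_sqrt_card) auto
  also have "\<dots> = (sqrt (2 * CARD('n)) * K)\<^sup>2"
    by (simp add: power_mult_distrib)
  also have "\<dots> \<le> C_\<mu>\<^sup>2"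
    using C_\<mu> K0 by (intro power_mono) (auto simp: K_def)
  finally have "(norm u)\<^sup>2 + (norm v)\<^sup>2 \<le> C_\<mu>\<^sup>2" .
  moreover have "(norm x)\<^sup>2 \<le> CARD('n)"
    using power_mono[OF nx, of 2] by simp
  moreover have "(norm l)\<^sup>2 \<le> C_lam\<^sup>2"
    using nl by (intro power_mono) auto
  ultimately have "(norm z)\<^sup>2 \<le> CARD('n) + C_lam\<^sup>2 + C_\<mu>\<^sup>2"
    by (simp add: norm_blocks[of z] defs)
  then show ?thesis by (rule real_le_rsqrt)
qed

text \<open>Each slack \<open>1 + x\<close>, \<open>1 - x\<close> and its multiplier are bounded below: their product is at least \<open>(1 - \<rho>) * \<tau>\<close>, while
  the slack is at most 2 and the multiplier at most \<open>C\<close>.\<close>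

lemma nbhd_gap:
  assumes z: "z \<in> nbhd Q c A b \<omega> \<rho> \<tau>" and C: "norm z \<le> C" "0 < C"
    and g: "g * 2 \<le> (1 - \<rho>) * \<tau>" "g * C \<le> (1 - \<rho>) * \<tau>"
  shows "g \<le> 1 + blk1 z $ i" "g \<le> 1 - blk1 z $ i" "g \<le> blk3 z $ i" "g \<le> blk4 z $ i"
proof -
  let ?x = "blk1 z $ i" and ?u = "blk3 z $ i" and ?v = "blk4 z $ i"
  have x: "\<bar>?x\<bar> < 1" and pos: "0 < ?u" "0 < ?v" using z by (simp_all add: nbhd_iff)
  have le: "?u \<le> C" "?v \<le> C"
    using component_le_norm_cart[of "blk3 z" i] component_le_norm_cart[of "blk4 z" i]
      norm_blk_le[of z] C by linarith+
  have prod: "(1 - \<rho>) * \<tau> \<le> ?u * (1 + ?x)" "(1 - \<rho>) * \<tau> \<le> ?v * (1 - ?x)"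
    using nbhd_complementarity[OF z, of i] by (simp_all add: algebra_simps)
  have "?u * (1 + ?x) \<le> ?u * 2" "?v * (1 - ?x) \<le> ?v * 2"
    using x pos by (simp_all add: abs_less_iff)
  then have "g * 2 \<le> ?u * 2" "g * 2 \<le> ?v * 2" using g prod by linarith+
  then show "g \<le> ?u" "g \<le> ?v" by simp_all
  have "?u * (1 + ?x) \<le> (1 + ?x) * C" "?v * (1 - ?x) \<le> (1 - ?x) * C"
    using x le by (simp_all add: abs_less_iff mult.commute mult_left_mono)
  then have "g * C \<le> (1 + ?x) * C" "g * C \<le> (1 - ?x) * C" using g prod by linarith+
  then show "g \<le> 1 + ?x" "g \<le> 1 - ?x" using \<open>0 < C\<close> by simp_all
qed

section \<open>Bounds on DF and on its inverse\<close>

lemma norm_DF_mult_le: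
  fixes Q :: "real^'n^'n" and A :: "real^'n^'m"
  assumes "0 \<le> \<omega>" and w: "norm w \<le> C"
  shows "norm (DF Q A \<omega> w *v d) \<le> (spec_norm Q + 2 * \<omega> + 2 * norm A + 4 + 4 * C) * norm d"
proof -
  let ?x = "blk1 d" and ?l = "blk2 d" and ?u = "blk3 d" and ?v = "blk4 d"
  have C: "0 \<le> C" using w norm_ge_zero order_trans by blast
  note le = norm_blk_le[of d]
  have wi: "\<bar>blk1 w $ i\<bar> \<le> C" "\<bar>blk3 w $ i\<bar> \<le> C" "\<bar>blk4 w $ i\<bar> \<le> C" for i
    using component_le_norm_cart[of "blk1 w" i] component_le_norm_cart[of "blk3 w" i]
      component_le_norm_cart[of "blk4 w" i] norm_blk_le[of w] w by linarith+
  have Q: "norm (Q *v ?x) \<le> spec_norm Q * norm d"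
    using norm_matrix_mult_le_onorm[of Q ?x] mult_left_mono[OF le(1), of "spec_norm Q"]
      onorm_pos_le[OF matrix_vector_mul_bounded_linear, of Q] by linarith
  have A: "norm (A *v ?x) \<le> norm A * norm d"
    using norm_matrix_mult_le_frobenius[of A ?x] mult_left_mono[OF le(1), of "norm A"] by simp
  have AT: "norm (transpose A *v ?l) \<le> norm A * norm d"
    using norm_transpose_mult_le[OF norm_matrix_mult_le_frobenius, of A ?l]
      mult_left_mono[OF le(2), of "norm A"] by simp
  have \<omega>: "norm (\<omega> *\<^sub>R ?x) \<le> \<omega> * norm d" "norm (\<omega> *\<^sub>R ?l) \<le> \<omega> * norm d"
    using assms le by (simp_all add: mult_left_mono)
  have 1: "norm (Q *v ?x + \<omega> *\<^sub>R ?x - transpose A *v ?l - ?u + ?v)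
      \<le> (spec_norm Q + \<omega> + norm A + 2) * norm d"
    using norm_triangle_ineq[of "Q *v ?x + \<omega> *\<^sub>R ?x - transpose A *v ?l - ?u" ?v]
      norm_triangle_ineq4[of "Q *v ?x + \<omega> *\<^sub>R ?x - transpose A *v ?l" ?u]
      norm_triangle_ineq4[of "Q *v ?x + \<omega> *\<^sub>R ?x" "transpose A *v ?l"]
      norm_triangle_ineq[of "Q *v ?x" "\<omega> *\<^sub>R ?x"] Q \<omega> AT le unfolding distrib_right by linarith
  have 2: "norm (A *v ?x + \<omega> *\<^sub>R ?l) \<le> (norm A + \<omega>) * norm d"
    using norm_triangle_ineq[of "A *v ?x" "\<omega> *\<^sub>R ?l"] A \<omega> unfolding distrib_right by linarith
  have row: "norm (p * y) \<le> k * norm d" if "\<And>i. \<bar>p $ i\<bar> \<le> k" "norm y \<le> norm d"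
    for p y :: "real^'n" and k
  proof -
    have "0 \<le> k" using that(1)[of undefined] by linarith
    then show ?thesis
      using norm_mult_le_component[OF that(1), of y] mult_left_mono[OF that(2), of k] by simp
  qed
  have pq: "\<bar>(1 + blk1 w) $ i\<bar> \<le> 1 + C" "\<bar>(1 - blk1 w) $ i\<bar> \<le> 1 + C" for i
    using wi(1)[of i] by auto
  have 3: "norm (blk3 w * ?x + (1 + blk1 w) * ?u) \<le> (1 + 2 * C) * norm d"
    using norm_triangle_ineq[of "blk3 w * ?x" "(1 + blk1 w) * ?u"]
      row[of "blk3 w" C ?x, OF wi(2) le(1)] row[of "1 + blk1 w" "1 + C" ?u, OF pq(1) le(3)]
    by (simp add: algebra_simps)
  have 4: "norm ((1 - blk1 w) * ?v - blk4 w * ?x) \<le> (1 + 2 * C) * norm d"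
    using norm_triangle_ineq4[of "(1 - blk1 w) * ?v" "blk4 w * ?x"]
      row[of "blk4 w" C ?x, OF wi(3) le(1)] row[of "1 - blk1 w" "1 + C" ?v, OF pq(2) le(4)]
    by (simp add: algebra_simps)
  have "norm (DF Q A \<omega> w *v d) \<le> (spec_norm Q + \<omega> + norm A + 2) * norm d
      + (norm A + \<omega>) * norm d + (1 + 2 * C) * norm d + (1 + 2 * C) * norm d"
    using norm_le_sum_blk[of "DF Q A \<omega> w *v d"] 1 2 3 4
    unfolding DF_mult_vec blk_blocks by linarith
  also have "\<dots> = (spec_norm Q + 2 * \<omega> + 2 * norm A + 4 + 4 * C) * norm d"
    unfolding distrib_right by simp
  finally show ?thesis .
qed

text \<open>The linearised complementarity equation \<open>y * x + p * u = 0\<close> gives \<open>x = - (p / y) * u\<close>, so the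
  coupling term \<open>- (x \<bullet> u)\<close> is a quadratic form in \<open>u\<close> with weights \<open>p / y \<ge> g / C\<close>.\<close>

lemma complementarity_energy:
  fixes x u y p :: "real^'n"
  assumes eq: "y * x + p * u = 0"
    and p: "\<And>i. g \<le> p $ i" and y: "\<And>i. 0 < y $ i" "\<And>i. y $ i \<le> C" and g: "0 < g"
  shows "g / C * (norm u)\<^sup>2 \<le> - (x \<bullet> u)"
proof -
  have C: "0 < C" using y[of undefined] by linarith
  have "g / C * (u $ i)\<^sup>2 \<le> - (x $ i * u $ i)" for i
  proof -
    have e: "x $ i = - (p $ i * u $ i / y $ i)"
      using arg_cong[OF eq, of "\<lambda>v. v $ i"] y(1)[of i] by (simp add: field_simps)
    have "g / C \<le> p $ i / y $ i"
      using p[of i] y[of i] g by (intro frac_le) auto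
    then have "g / C * (u $ i)\<^sup>2 \<le> p $ i / y $ i * (u $ i)\<^sup>2"
      by (rule mult_right_mono) simp
    then show ?thesis by (simp add: e power2_eq_square)
  qed
  then have "(\<Sum>i\<in>UNIV. g / C * (u $ i)\<^sup>2) \<le> (\<Sum>i\<in>UNIV. - (x $ i * u $ i))"
    by (intro sum_mono) simp
  moreover have "(\<Sum>i\<in>UNIV. g / C * (u $ i)\<^sup>2) = g / C * (norm u)\<^sup>2"
    unfolding power2_norm_eq_inner inner_vec_def sum_distrib_left by (simp add: power2_eq_square)
  ultimately show ?thesis
    by (simp add: inner_vec_def sum_negf)
qed

text \<open>The estimate comes from testing the first two block rows with \<open>(dx, dlam)\<close>. The last two blocks of
  the right-hand side have to vanish for \<open>complementarity_energy\<close> to apply.\<close>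

lemma DF_energy_estimate:
  fixes Q :: "real^'n^'n" and A :: "real^'n^'m"
  assumes Q: "\<And>v. 0 \<le> v \<bullet> (Q *v v)" and "0 < \<omega>" "0 < g"
    and gap: "\<And>i. g \<le> 1 + blk1 w $ i" "\<And>i. g \<le> 1 - blk1 w $ i"
    and pos: "\<And>i. 0 < blk3 w $ i" "\<And>i. 0 < blk4 w $ i"
    and C: "norm w \<le> C"
    and eq: "DF Q A \<omega> w *v d = blocks s1 s2 0 0"
  shows "norm d \<le> max (1 / \<omega>) (C / g) * norm (blocks s1 s2 0 0 :: real^('n, 'm) ix)"
proof -
  define x l u v where "x = blk1 d" and "l = blk2 d" and "u = blk3 d" and "v = blk4 d"
  let ?s = "blocks s1 s2 0 0 :: real^('n, 'm) ix"
  have e1: "Q *v x + \<omega> *\<^sub>R x - transpose A *v l - u + v = s1"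
    and e2: "A *v x + \<omega> *\<^sub>R l = s2"
    and e3: "blk3 w * x + (1 + blk1 w) * u = 0"
    and e4: "(1 - blk1 w) * v - blk4 w * x = 0"
    using arg_cong[OF eq, of blk1] arg_cong[OF eq, of blk2] arg_cong[OF eq, of blk3]
      arg_cong[OF eq, of blk4] by (simp_all add: DF_mult_vec x_def l_def u_def v_def)
  have bound: "blk3 w $ i \<le> C" "blk4 w $ i \<le> C" for i
    using component_le_norm_cart[of "blk3 w" i] component_le_norm_cart[of "blk4 w" i]
      norm_blk_le[of w] C by linarith+
  have C0: "0 < C" using bound(1) pos(1) by (meson less_le_trans)
  have u: "g / C * (norm u)\<^sup>2 \<le> - (x \<bullet> u)"
    by (rule complementarity_energy[OF e3]) (use gap pos bound \<open>0 < g\<close> in auto)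
  have e4': "blk4 w * (- x) + (1 - blk1 w) * v = 0" using e4 by (simp add: algebra_simps)
  have v: "g / C * (norm v)\<^sup>2 \<le> x \<bullet> v"
    using complementarity_energy[OF e4', of g C] gap pos bound \<open>0 < g\<close> by simp
  define k where "k = max (1 / \<omega>) (C / g)"
  have k: "0 < k" using \<open>0 < \<omega>\<close> by (simp add: k_def less_max_iff_disj)
  have k\<omega>: "1 / k \<le> \<omega>" and kg: "1 / k \<le> g / C"
  proof -
    have "1 / \<omega> \<le> k" "C / g \<le> k" by (simp_all add: k_def)
    then show "1 / k \<le> \<omega>" "1 / k \<le> g / C"
      using k \<open>0 < \<omega>\<close> \<open>0 < g\<close> C0 by (simp_all add: field_simps)
  qed
  \<comment> \<open>the two mixed terms in \<open>A\<close> cancel\<close>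
  have "x \<bullet> s1 + l \<bullet> s2 = x \<bullet> (Q *v x) + \<omega> * (norm x)\<^sup>2 + \<omega> * (norm l)\<^sup>2 - x \<bullet> u + x \<bullet> v"
  proof -
    have "x \<bullet> (transpose A *v l) = l \<bullet> (A *v x)"
      unfolding inner_transpose_mult by (rule inner_commute)
    then show ?thesis
      unfolding e1[symmetric] e2[symmetric]
      by (simp add: inner_add_right inner_diff_right power2_norm_eq_inner)
  qed
  then have "\<omega> * (norm x)\<^sup>2 + \<omega> * (norm l)\<^sup>2 + g / C * (norm u)\<^sup>2 + g / C * (norm v)\<^sup>2
      \<le> x \<bullet> s1 + l \<bullet> s2"
    using Q[of x] u v by linarith
  moreover have "1 / k * (norm d)\<^sup>2
      \<le> \<omega> * (norm x)\<^sup>2 + \<omega> * (norm l)\<^sup>2 + g / C * (norm u)\<^sup>2 + g / C * (norm v)\<^sup>2"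
    unfolding norm_blocks[of d] distrib_left x_def l_def u_def v_def
    using k\<omega> kg by (intro add_mono mult_right_mono) auto
  moreover have "x \<bullet> s1 + l \<bullet> s2 = d \<bullet> ?s"
    by (simp add: inner_blocks x_def l_def)
  moreover have "d \<bullet> ?s \<le> norm d * norm ?s"
    by (rule norm_cauchy_schwarz)
  ultimately have "1 / k * (norm d)\<^sup>2 \<le> norm d * norm ?s" by linarith
  then have "norm d * norm d \<le> norm d * (k * norm ?s)"
    using k by (simp add: field_simps power2_eq_square)
  then have "norm d \<le> k * norm ?s"
    using k by (cases "norm d = 0") auto
  then show ?thesis by (simp add: k_def)
qed

section \<open>The Newton step\<close>

lemma invertible_if_kernel_trivial:
  fixes M :: "real^'n^'n"
  assumes "\<And>d. M *v d = 0 \<Longrightarrow> d = 0"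
  shows "invertible M"
  using assms by (simp add: invertible_left_inverse matrix_left_invertible_ker)

lemma matrix_mult_matrix_inv: "invertible M \<Longrightarrow> M ** matrix_inv M = mat 1"
  unfolding invertible_def matrix_inv_def by (rule someI_ex[THEN conjunct1])

text \<open>The exact step from a point \<open>z\<close> near \<open>z0\<close>. Here \<open>2 * g\<close> is a lower bound for the slacks and
  multipliers at \<open>z0\<close>: one \<open>g\<close> remains at \<open>z\<close>, where \<open>DF\<close> is inverted, and the new point is within \<open>g\<close>
  of \<open>z0\<close>, hence again in the interior. \<open>L\<close> is a Lipschitz constant of \<open>F\<close> and \<open>M\<close> a bound on the
  inverse of \<open>DF z\<close> on the right-hand sides that occur.\<close>

lemma newton_step_in_nbhd:
  fixes Q :: "real^'n^'n" and A :: "real^'n^'m" and z z0 :: "real^('n, 'm) ix"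
  assumes r_def: "r = F Q c A b \<omega> \<tau> z"
    and Q: "\<And>v. 0 \<le> v \<bullet> (Q *v v)" and "0 < \<omega>" "0 < g" "0 \<le> M"
    and z0: "z0 \<in> nbhd Q c A b \<omega> \<rho> \<tau>" and near: "norm (z - z0) \<le> \<nu>"
    and C: "norm z0 \<le> C" "norm z \<le> C"
    and gap: "\<And>i. 2 * g \<le> 1 + blk1 z0 $ i" "\<And>i. 2 * g \<le> 1 - blk1 z0 $ i"
      "\<And>i. 2 * g \<le> blk3 z0 $ i" "\<And>i. 2 * g \<le> blk4 z0 $ i"
    and L: "spec_norm Q + 2 * \<omega> + 2 * norm A + 4 + 4 * C \<le> L"
    and M: "1 / \<omega> \<le> M" "C / g \<le> M"
    and radius: "(1 + M * L) * \<nu> \<le> g"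
    and residual: "L * \<nu> + (M * L * \<nu>)\<^sup>2 \<le> (\<rho>' - \<rho>) * \<tau>"
  shows "invertible (DF Q A \<omega> z)"
    and "z - matrix_inv (DF Q A \<omega> z) *v blocks (blk1 r) (blk2 r) 0 0 \<in> nbhd Q c A b \<omega> \<rho>' \<tau>"
proof -
  have "0 \<le> C" using C norm_ge_zero order_trans by blast
  then have L0: "0 \<le> L"
    using L \<open>0 < \<omega>\<close> onorm_pos_le[OF matrix_vector_mul_bounded_linear, of Q] norm_ge_zero[of A]
    by linarith
  have \<nu>0: "0 \<le> \<nu>" using near norm_ge_zero order_trans by blast
  have \<nu>g: "\<nu> \<le> g"
    using radius mult_nonneg_nonneg[OF mult_nonneg_nonneg[OF \<open>0 \<le> M\<close> L0] \<nu>0]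
    by (simp add: algebra_simps)
  have comp: "\<bar>blk1 y $ i\<bar> \<le> norm y" "\<bar>blk3 y $ i\<bar> \<le> norm y" "\<bar>blk4 y $ i\<bar> \<le> norm y"
    for y :: "real^('n, 'm) ix" and i
    using component_le_norm_cart[of "blk1 y" i] component_le_norm_cart[of "blk3 y" i]
      component_le_norm_cart[of "blk4 y" i] norm_blk_le[of y] by linarith+
  have gap_z: "g \<le> 1 + blk1 z $ i" "g \<le> 1 - blk1 z $ i" "g \<le> blk3 z $ i" "g \<le> blk4 z $ i"
    for i
    using comp[of "z - z0" i] near \<nu>g gap[of i] by (simp_all add: abs_le_iff)
  have pos_z: "0 < blk3 z $ i" "0 < blk4 z $ i" for i
    using gap_z[of i] \<open>0 < g\<close> by linarith+
  have energy: "norm d \<le> M * norm (blocks s1 s2 0 0 :: real^('n, 'm) ix)"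
    if "DF Q A \<omega> z *v d = blocks s1 s2 0 0" for d s1 s2
  proof -
    have "norm d \<le> max (1 / \<omega>) (C / g) * norm (blocks s1 s2 0 0 :: real^('n, 'm) ix)"
      using DF_energy_estimate[OF Q \<open>0 < \<omega>\<close> \<open>0 < g\<close> _ _ _ _ C(2) that] gap_z pos_z by blast
    also have "\<dots> \<le> M * norm (blocks s1 s2 0 0 :: real^('n, 'm) ix)"
      using M by (intro mult_right_mono) auto
    finally show ?thesis .
  qed
  have zero: "(0 :: real^('n, 'm) ix) = blocks 0 0 0 0" by (simp add: eq_blocks_iff)
  show inv: "invertible (DF Q A \<omega> z)"
  proof (rule invertible_if_kernel_trivial)
    fix d assume "DF Q A \<omega> z *v d = 0"
    then have "norm d \<le> M * norm (0 :: real^('n, 'm) ix)"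
      unfolding zero by (rule energy)
    then show "d = 0" by simp
  qed
  let ?s = "blocks (blk1 r) (blk2 r) 0 0 :: real^('n, 'm) ix"
  define d where "d = - (matrix_inv (DF Q A \<omega> z) *v ?s)"
  have DFd: "DF Q A \<omega> z *v d = blocks (- blk1 r) (- blk2 r) 0 0"
  proof -
    have "DF Q A \<omega> z *v (matrix_inv (DF Q A \<omega> z) *v ?s) = ?s"
      using inv by (simp add: matrix_vector_mul_assoc matrix_mult_matrix_inv)
    then have "DF Q A \<omega> z *v d = - ?s"
      by (simp add: d_def linear_neg[OF matrix_vector_mul_linear])
    also have "- ?s = blocks (- blk1 r) (- blk2 r) 0 0"
      using blk_diff[of 0 ?s] by (simp add: eq_blocks_iff)
    finally show ?thesis .
  qed
  define r0 where "r0 = F Q c A b \<omega> \<tau> z0"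
  have r_near: "norm (r - r0) \<le> L * \<nu>"
  proof -
    have "norm (midpoint z z0) \<le> C"
      using C norm_triangle_ineq[of z z0] by (simp add: midpoint_def)
    then have "norm (r - r0) \<le> (spec_norm Q + 2 * \<omega> + 2 * norm A + 4 + 4 * C) * norm (z - z0)"
      unfolding r_def r0_def F_diff_midpoint using \<open>0 < \<omega>\<close> by (intro norm_DF_mult_le) simp_all
    also have "\<dots> \<le> L * norm (z - z0)" using L by (rule mult_right_mono) simp
    also have "\<dots> \<le> L * \<nu>" using near L0 by (rule mult_left_mono)
    finally show ?thesis .
  qed
  have r0: "blk1 r0 = 0" "blk2 r0 = 0" "norm (blk3 r0, blk4 r0) \<le> \<rho> * \<tau>"
    using z0 unfolding nbhd_iff r0_def by blast+
  have "norm d \<le> M * norm (blocks (- blk1 r) (- blk2 r) 0 0 :: real^('n, 'm) ix)"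
    using DFd by (rule energy)
  also have "\<dots> \<le> M * norm (r - r0)"
  proof (rule mult_left_mono[OF _ \<open>0 \<le> M\<close>], rule power2_le_imp_le)
    show "(norm (blocks (- blk1 r) (- blk2 r) 0 0 :: real^('n, 'm) ix))\<^sup>2 \<le> (norm (r - r0))\<^sup>2"
      unfolding norm_blocks[where 'n = 'n and 'm = 'm] by (simp add: r0)
  qed simp
  also have "\<dots> \<le> M * (L * \<nu>)" using r_near \<open>0 \<le> M\<close> by (rule mult_left_mono)
  finally have d: "norm d \<le> M * L * \<nu>" by (simp add: mult.assoc)
  have Fd: "F Q c A b \<omega> \<tau> (z + d)
      = blocks 0 0 (blk3 r + blk3 d * blk1 d) (blk4 r - blk4 d * blk1 d)"
    unfolding F_expansion DFd r_def[symmetric] by (simp add: eq_blocks_iff)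
  have quad: "norm (blk3 d * blk1 d, - (blk4 d * blk1 d)) \<le> (norm d)\<^sup>2"
  proof -
    have sq: "(norm (y * blk1 d))\<^sup>2 \<le> (norm y)\<^sup>2 * (norm d)\<^sup>2" for y
    proof -
      have "norm (y * blk1 d) \<le> norm y * norm d"
        using norm_mult_le mult_left_mono[OF norm_blk_le(1) norm_ge_zero] by (rule order_trans)
      then show ?thesis unfolding power_mult_distrib[symmetric] by (rule power_mono) simp
    qed
    have "(norm (blk3 d))\<^sup>2 + (norm (blk4 d))\<^sup>2 \<le> (norm d)\<^sup>2"
      by (simp add: norm_blocks[of d])
    then have "((norm (blk3 d))\<^sup>2 + (norm (blk4 d))\<^sup>2) * (norm d)\<^sup>2 \<le> (norm d)\<^sup>2 * (norm d)\<^sup>2"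
      by (rule mult_right_mono) simp
    then have "(norm (blk3 d * blk1 d))\<^sup>2 + (norm (blk4 d * blk1 d))\<^sup>2 \<le> ((norm d)\<^sup>2)\<^sup>2"
      using sq[of "blk3 d"] sq[of "blk4 d"] unfolding power2_eq_square[of "(norm d)\<^sup>2"] distrib_right
      by linarith
    then show ?thesis by (simp add: norm_Pair real_le_lsqrt)
  qed
  have "norm (blk3 r + blk3 d * blk1 d, blk4 r - blk4 d * blk1 d) \<le> \<rho>' * \<tau>"
  proof -
    have "(blk3 r + blk3 d * blk1 d, blk4 r - blk4 d * blk1 d) = (blk3 r0, blk4 r0)
        + (blk3 (r - r0), blk4 (r - r0)) + (blk3 d * blk1 d, - (blk4 d * blk1 d))"
      by simp
    then have "norm (blk3 r + blk3 d * blk1 d, blk4 r - blk4 d * blk1 d)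
        \<le> norm (blk3 r0, blk4 r0) + norm (blk3 (r - r0), blk4 (r - r0))
          + norm (blk3 d * blk1 d, - (blk4 d * blk1 d))"
      by (simp only: norm_triangle_mono norm_triangle_ineq order_refl)
    moreover have "norm (blk3 (r - r0), blk4 (r - r0)) \<le> L * \<nu>"
      using norm_blk_le(5) r_near order_trans by blast
    moreover have "(norm d)\<^sup>2 \<le> (M * L * \<nu>)\<^sup>2" using d by (rule power_mono) simp
    ultimately show ?thesis
      using r0(3) quad residual unfolding left_diff_distrib by linarith
  qed
  moreover have "norm (z + d - z0) \<le> g"
  proof -
    have "norm (z + d - z0) \<le> norm (z - z0) + norm d"
      using norm_triangle_ineq[of "z - z0" d] by (simp add: algebra_simps)
    then show ?thesis using near d radius unfolding distrib_right by linarith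
  qed
  then have "\<bar>blk1 (z + d) $ i\<bar> < 1 \<and> 0 < blk3 (z + d) $ i \<and> 0 < blk4 (z + d) $ i" for i
    using comp[of "z + d - z0" i] gap[of i] \<open>0 < g\<close> by (auto simp: abs_le_iff abs_less_iff)
  ultimately have "z + d \<in> nbhd Q c A b \<omega> \<rho>' \<tau>"
    unfolding nbhd_iff Fd blk_blocks by blast
  then show "z - matrix_inv (DF Q A \<omega> z) *v ?s \<in> nbhd Q c A b \<omega> \<rho>' \<tau>"
    by (simp add: d_def)
qed

section \<open>Existence of a sufficient machine precision\<close>

theorem theorem4p5:
  fixes Q :: "real^'n^'n" and c :: "real^'n" and A :: "real^'n^'m" and b :: "real^'m"
    and tol \<theta> \<beta> \<sigma> C_q \<omega> C_lam C_\<Delta>\<mu> \<tau>A \<tau>E C_\<mu> C_z c_gap C_DF C_DFinv \<kappa>DF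
      C_\<delta>F C_\<delta>DF C_\<delta>\<Delta>z C_\<nu> \<nu>2 \<nu>1 \<nu>0 solver_const :: real
  assumes "sym_psd Q" and "tol > 0"
    and "0 < \<theta>" "\<theta> \<le> 0.3"
    and "0 < \<beta>" "\<beta> \<le> \<theta>"
    and "0 < \<sigma>" "1 - \<beta> / sqrt (2 * CARD('n)) \<le> \<sigma>" "\<sigma> < 1"
    and "0 < C_q" "C_q \<ge> spec_norm Q * CARD('n) + norm c * sqrt CARD('n)"
    and "0 < \<omega>" "\<omega> \<le> min (tol / (2 * CARD('n))) (min (tol^2 / (16 * (4 * C_q + CARD('n)))) 1)"
    and "0 < C_lam" "C_lam \<ge> (spec_norm A * sqrt CARD('n) + norm b) / \<omega>"
    and "0 < C_\<Delta>\<mu>" "C_\<Delta>\<mu> \<ge> (\<omega> + spec_norm Q) * sqrt CARD('n) + norm c + spec_norm A * C_lam"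
    and "0 < \<tau>A" "\<tau>A \<ge> max (1/4 * spec_norm (Q + mat \<omega> + (1/\<omega>) *\<^sub>R (transpose A ** A)))
                        (4 * norm (c - (1/\<omega>) *\<^sub>R (transpose A *v b)))"
    and "0 < \<tau>E" "\<tau>E \<le> tol^2 * \<omega> / (48 * CARD('n) * max (spec_norm A) C_q)"
    and "0 < C_\<mu>" "C_\<mu> \<ge> sqrt (2 * CARD('n)) * (C_\<Delta>\<mu> + (1 + \<theta>) * \<tau>A)"
    and "0 < C_z" "C_z \<ge> sqrt (CARD('n) + C_lam^2 + C_\<mu>^2) + 0.1"
    and "0 < c_gap" "c_gap \<le> (1 - \<theta>) / (1 + C_z) * (\<sigma> * \<tau>E / 2)"
    and "0 < C_DF" "C_DF \<ge> spec_norm Q + 2 * \<omega> + 2 * norm A + 4 + 4 * C_z"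
    and "0 < C_DFinv" "C_DFinv \<ge> 1 / c_gap * max (1 / \<omega>) (C_z / c_gap)"
    and "0 < \<kappa>DF" "\<kappa>DF \<ge> C_DF * C_DFinv"
    and "0 < C_\<delta>F" "C_\<delta>F \<ge> C_DF"
    and "0 < C_\<delta>DF" "C_\<delta>DF \<ge> 2"
    and "0 < C_\<delta>\<Delta>z" "C_\<delta>\<Delta>z \<ge> 2 * \<kappa>DF"
    and "0 < C_\<nu>" "C_\<nu> \<ge> max (2 * C_\<delta>\<Delta>z * (C_\<delta>F * C_DFinv + 2 / \<omega> * C_\<delta>DF * C_z))
                        (1 + C_DFinv * C_\<delta>F)"
    and "0 < \<nu>2" "\<nu>2 \<le> min (min 0.1 (c_gap / C_\<nu>))
                        (min (\<omega> / (2 * C_\<delta>DF * \<kappa>DF)) (\<theta> * \<sigma> * \<tau>E / (2 * C_\<nu> * C_\<delta>F)))"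
    and "0 < \<nu>1" "\<nu>1 \<le> \<nu>2 / C_\<nu>"
    and "0 < \<nu>0" "\<nu>0 \<le> min (\<nu>1 / C_\<nu>) (tol / (2 * max (spec_norm A) C_q))"
    and "0 \<le> solver_const"
  shows "\<exists>\<epsilon>0>0. \<forall>\<epsilon>mach. 0 < \<epsilon>mach \<and> \<epsilon>mach \<le> \<epsilon>0 \<longrightarrow>
    (\<forall>\<tau>\<in>{\<sigma> * \<tau>E..\<tau>A}. \<forall>z\<in>tube (nbhd Q c A b \<omega> (0.5 * \<theta>) \<tau>) \<nu>2.
      invertible (DF Q A \<omega> z) \<and>
      (\<forall>r e zhat.
        r = F Q c A b \<omega> \<tau> z \<and>
        norm e \<le> solver_const * C_z * \<kappa>DF * \<epsilon>mach \<and>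
        zhat = z - matrix_inv (DF Q A \<omega> z) *v blocks (blk1 r) (blk2 r) 0 0 + e \<longrightarrow>
          zhat \<in> tube (nbhd Q c A b \<omega> \<theta> \<tau>) \<nu>0 \<and>
          (e = 0 \<longrightarrow> zhat \<in> nbhd Q c A b \<omega> \<theta> \<tau>)))"
proof -
  note \<theta> = \<open>0 < \<theta>\<close> \<open>\<theta> \<le> 0.3\<close>
  \<comment> \<open>the step is at most \<open>K\<close> times as long as the distance to the unperturbed point\<close>
  define K where "K = C_DFinv * C_\<delta>F"
  have K0: "0 < K" using \<open>0 < C_DFinv\<close> \<open>0 < C_\<delta>F\<close> by (simp add: K_def)
  have K: "1 + K \<le> C_\<nu>"
    using \<open>C_\<nu> \<ge> max _ (1 + C_DFinv * C_\<delta>F)\<close> by (simp add: K_def)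
  have radius: "(1 + K) * \<nu>2 \<le> c_gap"
  proof -
    have "\<nu>2 \<le> c_gap / C_\<nu>" using \<open>\<nu>2 \<le> min _ _\<close> by simp
    then have "C_\<nu> * \<nu>2 \<le> c_gap" using \<open>0 < C_\<nu>\<close> by (simp add: field_simps)
    moreover have "(1 + K) * \<nu>2 \<le> C_\<nu> * \<nu>2" using K \<open>0 < \<nu>2\<close> by (intro mult_right_mono) auto
    ultimately show ?thesis by linarith
  qed
  have budget: "C_\<delta>F * ((1 + K) * \<nu>2) \<le> \<theta> * (\<sigma> * \<tau>E) / 2"
  proof -
    have "\<nu>2 \<le> \<theta> * \<sigma> * \<tau>E / (2 * C_\<nu> * C_\<delta>F)" using \<open>\<nu>2 \<le> min _ _\<close> by simp
    then have "C_\<delta>F * (C_\<nu> * \<nu>2) \<le> \<theta> * (\<sigma> * \<tau>E) / 2"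
      using \<open>0 < C_\<nu>\<close> \<open>0 < C_\<delta>F\<close> by (simp add: field_simps)
    moreover have "C_\<delta>F * ((1 + K) * \<nu>2) \<le> C_\<delta>F * (C_\<nu> * \<nu>2)"
      using K \<open>0 < \<nu>2\<close> \<open>0 < C_\<delta>F\<close> by (intro mult_left_mono mult_right_mono) auto
    ultimately show ?thesis by linarith
  qed
  have Cz1: "1 \<le> C_z"
  proof -
    have "1 \<le> sqrt (CARD('n) + C_lam\<^sup>2 + C_\<mu>\<^sup>2)"
      by (simp add: Suc_leI add_increasing2)
    then show ?thesis using \<open>C_z \<ge> sqrt _ + 0.1\<close> by linarith
  qed
  have gap: "2 * c_gap * (1 + C_z) \<le> (1 - \<theta>) * (\<sigma> * \<tau>E)"
    using \<open>c_gap \<le> _\<close> Cz1 by (simp add: field_simps)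
  have L: "spec_norm Q + 2 * \<omega> + 2 * norm A + 4 + 4 * C_z \<le> C_\<delta>F"
    using \<open>C_DF \<ge> _\<close> \<open>C_\<delta>F \<ge> C_DF\<close> by linarith
  have L4: "4 \<le> C_\<delta>F"
    using L \<open>0 < \<omega>\<close> \<open>0 < C_z\<close> onorm_pos_le[OF matrix_vector_mul_bounded_linear, of Q]
      norm_ge_zero[of A] by linarith
  have exact: "invertible (DF Q A \<omega> z) \<and> z - matrix_inv (DF Q A \<omega> z) *v
      blocks (blk1 (F Q c A b \<omega> \<tau> z)) (blk2 (F Q c A b \<omega> \<tau> z)) 0 0 \<in> nbhd Q c A b \<omega> \<theta> \<tau>"
    if \<tau>: "\<tau> \<in> {\<sigma> * \<tau>E..\<tau>A}" and z: "z \<in> tube (nbhd Q c A b \<omega> (0.5 * \<theta>) \<tau>) \<nu>2" for \<tau> z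
  proof -
    obtain z0 where z0: "z0 \<in> nbhd Q c A b \<omega> (0.5 * \<theta>) \<tau>" and near: "norm (z - z0) \<le> \<nu>2"
      using z by (auto simp: tube_def)
    have \<tau>0: "0 < \<tau>" using \<tau> \<open>0 < \<sigma>\<close> \<open>0 < \<tau>E\<close> by (meson atLeastAtMost_iff less_le_trans mult_pos_pos)
    have "norm z0 \<le> sqrt (CARD('n) + C_lam\<^sup>2 + C_\<mu>\<^sup>2)"
      by (rule nbhd_norm_le[OF z0 _ _ _ _ \<open>0 < \<omega>\<close> \<open>C_lam \<ge> _\<close> \<open>C_\<Delta>\<mu> \<ge> _\<close> \<open>C_\<mu> \<ge> _\<close>])
        (use \<theta> \<tau> \<tau>0 in auto)
    then have z0C: "norm z0 \<le> C_z - 0.1" using \<open>C_z \<ge> sqrt _ + 0.1\<close> by linarith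
    have zC: "norm z \<le> C_z"
    proof -
      have "\<nu>2 \<le> 0.1" using \<open>\<nu>2 \<le> min _ _\<close> by simp
      then show ?thesis using z0C near norm_triangle_sub[of z z0] by linarith
    qed
    have g: "2 * c_gap * (1 + C_z) \<le> (1 - 0.5 * \<theta>) * \<tau>"
    proof -
      have "(1 - \<theta>) * (\<sigma> * \<tau>E) \<le> (1 - 0.5 * \<theta>) * \<tau>"
        using \<theta> \<tau> \<open>0 < \<sigma>\<close> \<open>0 < \<tau>E\<close> by (intro mult_mono) auto
      then show ?thesis using gap by linarith
    qed
    have g2: "2 * c_gap * 2 \<le> (1 - 0.5 * \<theta>) * \<tau>"
      using g mult_left_mono[of 2 "1 + C_z" "2 * c_gap"] Cz1 \<open>0 < c_gap\<close> by linarith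
    have gC: "2 * c_gap * C_z \<le> (1 - 0.5 * \<theta>) * \<tau>"
      using g mult_left_mono[of C_z "1 + C_z" "2 * c_gap"] \<open>0 < c_gap\<close> by linarith
    have "norm z0 \<le> C_z" using z0C by simp
    note gaps = nbhd_gap[OF z0 this \<open>0 < C_z\<close> g2 gC]
    have gap1: "c_gap \<le> 1" using gaps(1,2)[of undefined] by linarith
    \<comment> \<open>as \<open>c_gap \<le> 1\<close>, the factor \<open>1 / c_gap\<close> in the bound on \<open>C_DFinv\<close> can be dropped\<close>
    have M: "1 / \<omega> \<le> C_DFinv" "C_z / c_gap \<le> C_DFinv"
    proof -
      have "1 * max (1 / \<omega>) (C_z / c_gap) \<le> 1 / c_gap * max (1 / \<omega>) (C_z / c_gap)"
        using gap1 \<open>0 < c_gap\<close> \<open>0 < \<omega>\<close> by (intro mult_right_mono) (auto simp: le_max_iff_disj)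
      then have "max (1 / \<omega>) (C_z / c_gap) \<le> C_DFinv" using \<open>C_DFinv \<ge> _\<close> by linarith
      then show "1 / \<omega> \<le> C_DFinv" "C_z / c_gap \<le> C_DFinv" by simp_all
    qed
    \<comment> \<open>as \<open>K * \<nu>2 \<le> c_gap \<le> C_\<delta>F\<close>, the second-order term is absorbed by the factor \<open>1 + K\<close>\<close>
    have res: "C_\<delta>F * \<nu>2 + (K * \<nu>2)\<^sup>2 \<le> (\<theta> - 0.5 * \<theta>) * \<tau>"
    proof -
      have "K * \<nu>2 \<le> C_\<delta>F" using radius gap1 L4 \<open>0 < \<nu>2\<close> unfolding distrib_right by linarith
      then have "(K * \<nu>2)\<^sup>2 \<le> C_\<delta>F * (K * \<nu>2)"
        unfolding power2_eq_square using K0 \<open>0 < \<nu>2\<close> by (intro mult_right_mono) auto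
      then have "C_\<delta>F * \<nu>2 + (K * \<nu>2)\<^sup>2 \<le> \<theta> * (\<sigma> * \<tau>E) / 2"
        using budget by (simp add: algebra_simps)
      also have "\<dots> \<le> \<theta> * \<tau> / 2" using \<theta> \<tau> by simp
      finally show ?thesis by (simp add: algebra_simps)
    qed
    have psd: "0 \<le> v \<bullet> (Q *v v)" for v using \<open>sym_psd Q\<close> by (simp add: sym_psd_def)
    note step = newton_step_in_nbhd[OF refl psd \<open>0 < \<omega>\<close> \<open>0 < c_gap\<close> less_imp_le[OF \<open>0 < C_DFinv\<close>]
        z0 near \<open>norm z0 \<le> C_z\<close> zC gaps L M radius[unfolded K_def] res[unfolded K_def]]
    show ?thesis using step by blast
  qed
  define k where "k = solver_const * C_z * \<kappa>DF"
  have k: "0 \<le> k"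
    using \<open>0 \<le> solver_const\<close> \<open>0 < C_z\<close> \<open>0 < \<kappa>DF\<close> by (simp add: k_def)
  \<comment> \<open>\<open>k\<close> may be zero, hence \<open>k + 1\<close>\<close>
  define \<epsilon>0 where "\<epsilon>0 = \<nu>0 / (k + 1)"
  have \<epsilon>0: "0 < \<epsilon>0" using k \<open>0 < \<nu>0\<close> by (simp add: \<epsilon>0_def)
  have small: "k * \<epsilon> \<le> \<nu>0" if "\<epsilon> \<le> \<epsilon>0" for \<epsilon>
  proof -
    have "k * \<epsilon> \<le> k * \<epsilon>0" using that k by (rule mult_left_mono)
    also have "\<dots> \<le> (k + 1) * \<epsilon>0" using \<epsilon>0 by (intro mult_right_mono) auto
    also have "\<dots> = \<nu>0" using k by (simp add: \<epsilon>0_def)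
    finally show ?thesis .
  qed
  show ?thesis
  proof (intro exI[of _ \<epsilon>0] conjI allI impI ballI \<epsilon>0; (elim conjE)?)
    fix \<epsilon> \<tau> z
    assume "\<tau> \<in> {\<sigma> * \<tau>E..\<tau>A}" "z \<in> tube (nbhd Q c A b \<omega> (0.5 * \<theta>) \<tau>) \<nu>2"
    note ex = exact[OF this]
    then show "invertible (DF Q A \<omega> z)" by blast
    fix r e zhat
    assume r: "r = F Q c A b \<omega> \<tau> z"
      and zhat: "zhat = z - matrix_inv (DF Q A \<omega> z) *v blocks (blk1 r) (blk2 r) 0 0 + e"
    have in_nbhd: "zhat - e \<in> nbhd Q c A b \<omega> \<theta> \<tau>" using ex by (simp add: zhat r)
    then show "zhat \<in> nbhd Q c A b \<omega> \<theta> \<tau>" if "e = 0" using that by simp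
    assume "\<epsilon> \<le> \<epsilon>0" "norm e \<le> solver_const * C_z * \<kappa>DF * \<epsilon>"
    then have "norm (zhat - (zhat - e)) \<le> \<nu>0" using small[of \<epsilon>] by (simp add: k_def)
    then show "zhat \<in> tube (nbhd Q c A b \<omega> \<theta> \<tau>) \<nu>0"
      using in_nbhd unfolding tube_def by blast
  qed
qed

end
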